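(* Let $(\Omega,\mu,d)$ be a metric measure space satisfying the standing assumptions, let $w$ be an isoperimetric weight on $\Omega$ with constant $C(w)$, and let $\alpha>0$. If $\mu(\Omega)<\infty$, then for every $f\in Lip(\Omega)$ such that $m(f)=0$ (that is, $0$ is a median of $f$) or $\int_\Omega f\,d\mu=0$, $$\|f\|_{1}\le 2C(w)\,r\,\big\||\nabla f|\big\|_{1}+2r^{-\alpha}\|w^{\alpha}f\|_{1}\quad\text{for all } r>0 .$$ If $\mu(\Omega)=\infty$, then the same inequality holds for every $f\in Lip_0(\Omega)$ and all $r>0$. Here $\|\cdot\|_1$ is the norm of $L^1(\Omega,\mu)$.
   Context: Setting and standing assumptions. $(\Omega,\mu,d)$ is a connected metric space with a Borel measure $\mu$ such that $\mu(K)<\infty$ for every compact $K\subset\Omega$. $Lip(\Omega)$ is the set of real-valued Lipschitz functions on $\Omega$ and $Lip_0(\Omega)$ the set of those with compact support. For $f\in Lip(\Omega)$, $|\nabla f(x)|=\limsup_{d(x,y)\to0}\frac{|f(x)-f(y)|}{d(x,y)}$. For a Borel set $A\subset\Omega$, $\mu^+(A)=\liminf_{h\to0}\frac{\mu(A_h)-\mu(A)}{h}$, where $A_h=\{x\in\Omega:d(x,A)<h\}$. The isoperimetric profile is $I:[0,\mu(\Omega))\to\mathbb{R}_+$, $I(t)=\inf\{\mu^+(A):\mu(A)=t\}$. It is assumed throughout that $I$ is concave, continuous and $I(0)=0$; when $\mu(\Omega)<\infty$ it is also assumed that $I$ is symmetric around $\mu(\Omega)/2$ (so $I$ is increasing on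 $(0,\mu(\Omega)/2)$ and decreasing on $(\mu(\Omega)/2,\mu(\Omega))$); when $\mu(\Omega)=\infty$ it is assumed that $I$ is increasing. It is understood that $I>0$ on $(0,\mu(\Omega))$; the (non-decreasing) quotient $t/I(t)$ is read as $0$ at $t=0$ and as its limit at $t=\infty$. Median (when $\mu(\Omega)<\infty$). A real number $m(f)$ is a median of an integrable $f$ if $\mu\{f\ge m(f)\}\ge\mu(\Omega)/2$ and $\mu\{f\le m(f)\}\ge\mu(\Omega)/2$. Isoperimetric weight. A locally integrable $w:\Omega\to\mathbb{R}_+$ with $w>0$ a.e. is an isoperimetric weight if $$C(w):=\sup_{r>0}\frac1r\,\frac{\min\{\mu(\{w\le r\}),\mu(\Omega)/2\}}{I(\min\{\mu(\{w\le r\}),\mu(\Omega)/2\})}<\infty .$$ When $\mu(\Omega)=\infty$ the minimum is simply $\mu(\{w\le r\})$. *)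

theory Defs
  imports "HOL-Analysis.Analysis"
begin

text \<open>For continuous \<open>f\<close> this is a Borel function, so its \<open>nn_integral\<close> is the usual one.\<close>

definition grad_modulus :: "('a::metric_space \<Rightarrow> real) \<Rightarrow> 'a \<Rightarrow> ennreal" where
  "grad_modulus f x = Limsup (at x) (\<lambda>y. ennreal (\<bar>f x - f y\<bar> / dist x y))"

definition Lip :: "('a::metric_space \<Rightarrow> real) set" where
  "Lip = {f. \<exists>L. L-lipschitz_on UNIV f}"

definition Lip0 :: "('a::metric_space \<Rightarrow> real) set" where
  "Lip0 = {f \<in> Lip. compact (closure {x. f x \<noteq> 0})}"

text \<open>The condition \<open>A \<noteq> {}\<close> encodes the convention \<open>d(x, {}) = \<infinity>\<close>; the library has \<open>infdist x {} = 0\<close>.\<close>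

definition enlargement :: "'a::metric_space set \<Rightarrow> real \<Rightarrow> 'a set" where
  "enlargement A h = {x. A \<noteq> {} \<and> infdist x A < h}"

text \<open>Below, this is used only for sets of finite measure, where the subtraction is the genuine one.\<close>

definition boundary_measure :: "'a::metric_space measure \<Rightarrow> 'a set \<Rightarrow> ennreal" where
  "boundary_measure M A =
     Liminf (at_right 0) (\<lambda>h. (emeasure M (enlargement A h) - emeasure M A) / ennreal h)"

definition profile_domain :: "'a measure \<Rightarrow> real set" where
  "profile_domain M = {t. 0 \<le> t \<and> ennreal t < emeasure M (space M)}"

definition isoperimetric_profile :: "'a::metric_space measure \<Rightarrow> real \<Rightarrow> ennreal" where
  "isoperimetric_profile M t = (INF A \<in> {A \<in> sets M. emeasure M A = ennreal t}. boundary_measure M A)"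

text \<open>The profile takes values in \<open>[0, \<infinity>]\<close> by definition; that it is a real-valued function on
  its domain is the assumption \<open>profile_finite\<close>.\<close>

locale isoperimetric_space =
  fixes M :: "'a::metric_space measure"
  assumes connected_space: "connected (UNIV :: 'a set)"
    and sets_eq_borel: "sets M = sets borel"
    and compact_finite: "\<And>K. compact K \<Longrightarrow> emeasure M K < \<infinity>"
    and profile_finite: "\<And>t. t \<in> profile_domain M \<Longrightarrow> isoperimetric_profile M t < \<infinity>"
    and profile_concave: "concave_on (profile_domain M) (\<lambda>t. enn2real (isoperimetric_profile M t))"
    and profile_continuous:
      "continuous_on (profile_domain M) (\<lambda>t. enn2real (isoperimetric_profile M t))"
    and profile_0: "isoperimetric_profile M 0 = 0"
    and profile_pos: "\<And>t. t \<in> profile_domain M \<Longrightarrow> 0 < t \<Longrightarrow> 0 < isoperimetric_profile M t"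
    and profile_symmetric:
      "\<And>t. emeasure M (space M) < \<infinity> \<Longrightarrow> 0 < t \<Longrightarrow> t < measure M (space M) \<Longrightarrow>
         isoperimetric_profile M (measure M (space M) - t) = isoperimetric_profile M t"
    and profile_increasing:
      "emeasure M (space M) = \<infinity> \<Longrightarrow> mono_on {0..} (isoperimetric_profile M)"

definition is_median :: "'a measure \<Rightarrow> ('a \<Rightarrow> real) \<Rightarrow> real \<Rightarrow> bool" where
  "is_median M f m \<longleftrightarrow> integrable M f \<and>
     emeasure M {x \<in> space M. f x \<ge> m} \<ge> emeasure M (space M) / 2 \<and>
     emeasure M {x \<in> space M. f x \<le> m} \<ge> emeasure M (space M) / 2"

text \<open>The quotient \<open>t / I(t)\<close>, extended by \<open>0\<close> at \<open>0\<close> and by its limit at \<open>\<infinity>\<close>.\<close>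

definition profile_quotient :: "'a::metric_space measure \<Rightarrow> ennreal \<Rightarrow> ennreal" where
  "profile_quotient M t =
     (if t = 0 then 0
      else if t = \<infinity> then Lim at_top (\<lambda>s::real. ennreal s / isoperimetric_profile M s)
      else t / isoperimetric_profile M (enn2real t))"

text \<open>If the total measure is infinite, then so is its half in \<open>ennreal\<close>, and the minimum is its
  first argument.\<close>

definition weight_constant :: "'a::metric_space measure \<Rightarrow> ('a \<Rightarrow> real) \<Rightarrow> ennreal" where
  "weight_constant M w =
     (SUP r\<in>{0<..}. ennreal (1 / r) *
        profile_quotient M (min (emeasure M {x \<in> space M. w x \<le> r}) (emeasure M (space M) / 2)))"

text \<open>Local integrability is integrability on compact sets.\<close>

definition isoperimetric_weight :: "'a::metric_space measure \<Rightarrow> ('a \<Rightarrow> real) \<Rightarrow> bool" where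
  "isoperimetric_weight M w \<longleftrightarrow>
     w \<in> borel_measurable M \<and> (\<forall>x. 0 \<le> w x) \<and>
     (\<forall>K. compact K \<longrightarrow> set_integrable M K w) \<and>
     (AE x in M. 0 < w x) \<and>
     weight_constant M w < \<infinity>"

end

theory Submission
  imports Defs
begin

text \<open>Split \<open>\<integral>f\<close> at \<open>A = {w \<le> r}\<close>, for \<open>f \<ge> 0\<close> supported on at most half of the space. Off \<open>A\<close>,
  \<open>1 \<le> (w / r)\<^sup>\<alpha>\<close>. On \<open>A\<close>, the layer-cake formula bounds the integral by
  \<open>\<integral> min {\<mu> A, \<mu> {f > t}} dt\<close>; writing \<open>b = min {\<mu> A, \<mu> \<Omega> / 2}\<close>, the monotonicity of \<open>t / I t\<close> and of
  \<open>I\<close> below \<open>\<mu> \<Omega> / 2\<close> bounds the integrand by \<open>b / I b \<cdot> I (\<mu> {f > t})\<close>, and the coarea inequality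
  \<open>\<integral> \<mu>\<^sup>+ {f > t} dt \<le> \<integral> |\<nabla>f|\<close> together with \<open>b / I b \<le> C(w) r\<close> concludes. A function of median \<open>0\<close> is
  treated through its positive and negative part. If the mean is \<open>0\<close> instead, one of the two parts
  lives on at most half of the space, and both have integral \<open>\<parallel>f\<parallel>\<^sub>1 / 2\<close>.\<close>


section \<open>Layer-cake formula\<close>

text \<open>Tonelli for the region between the graphs of \<open>u\<close> and \<open>v\<close>.
  \<open>M\<close> is not assumed sigma-finite, so it is first cut down to \<open>U\<close>, off
  which the integrand and the slices vanish. The measurability claim comes from the same product and
  is what allows integrating the slices over \<open>t\<close>.\<close>

lemma
  fixes u v :: "'a \<Rightarrow> real"
  assumes u[measurable]: "u \<in> borel_measurable M" and v[measurable]: "v \<in> borel_measurable M"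
    and U[measurable]: "U \<in> sets M" and finU: "emeasure M U < \<infinity>"
    and le: "\<And>x. u x \<le> v x" and off: "\<And>x. x \<notin> U \<Longrightarrow> u x = v x"
  shows borel_measurable_emeasure_between:
      "(\<lambda>t. emeasure M {x \<in> space M. u x \<le> t \<and> t < v x}) \<in> borel_measurable lborel"
    and nn_integral_diff_eq_layer_cake: "(\<integral>\<^sup>+x. ennreal (v x - u x) \<partial>M) =
    (\<integral>\<^sup>+t. emeasure M {x \<in> space M. u x \<le> t \<and> t < v x} \<partial>lborel)"
proof -
  define N where "N = density M (indicator U)"
  interpret N: finite_measure N
    using finU by (intro finite_measureI) (simp add: N_def emeasure_density less_top)
  interpret pair_sigma_finite N "lborel :: real measure" ..
  have [measurable_cong]: "sets N = sets M" by (simp add: N_def)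
  define f :: "'a \<times> real \<Rightarrow> ennreal" where
    "f = (\<lambda>(x, t). indicator {p \<in> space (N \<Otimes>\<^sub>M lborel). u (fst p) \<le> snd p \<and> snd p < v (fst p)} (x, t))"
  have [measurable]: "f \<in> borel_measurable (N \<Otimes>\<^sub>M lborel)"
    unfolding f_def by measurable
  have sp: "space N = space M" by (simp add: N_def)
  have 1: "(\<integral>\<^sup>+t. f (x, t) \<partial>lborel) = ennreal (v x - u x)" if "x \<in> space M" for x
  proof -
    have "(\<integral>\<^sup>+t. f (x, t) \<partial>lborel) = (\<integral>\<^sup>+t. indicator {u x..<v x} t \<partial>lborel)"
      using that by (intro nn_integral_cong) (auto simp: f_def sp space_pair_measure indicator_def)
    then show ?thesis using le[of x] by simp
  qed
  have 2: "(\<integral>\<^sup>+x. f (x, t) \<partial>N) = emeasure M {x \<in> space M. u x \<le> t \<and> t < v x}" for t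
  proof -
    have "(\<integral>\<^sup>+x. f (x, t) \<partial>N) = (\<integral>\<^sup>+x. indicator U x * f (x, t) \<partial>M)"
      unfolding N_def by (rule nn_integral_density) (auto simp: f_def)
    also have "\<dots> = (\<integral>\<^sup>+x. indicator {x \<in> space M. u x \<le> t \<and> t < v x} x \<partial>M)"
      using off by (intro nn_integral_cong) (fastforce simp: f_def sp space_pair_measure indicator_def)
    finally show ?thesis by simp
  qed
  have "(\<integral>\<^sup>+x. ennreal (v x - u x) \<partial>M) = (\<integral>\<^sup>+x. indicator U x * ennreal (v x - u x) \<partial>M)"
    using off by (intro nn_integral_cong) (auto simp: indicator_def)
  also have "\<dots> = (\<integral>\<^sup>+x. ennreal (v x - u x) \<partial>N)"
    unfolding N_def by (rule nn_integral_density[symmetric]) auto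
  also have "\<dots> = (\<integral>\<^sup>+x. (\<integral>\<^sup>+t. f (x, t) \<partial>lborel) \<partial>N)"
    by (intro nn_integral_cong) (simp add: 1 sp)
  also have "\<dots> = (\<integral>\<^sup>+t. (\<integral>\<^sup>+x. f (x, t) \<partial>N) \<partial>lborel)"
    by (rule Fubini[symmetric]) measurable
  finally show "(\<integral>\<^sup>+x. ennreal (v x - u x) \<partial>M) =
    (\<integral>\<^sup>+t. emeasure M {x \<in> space M. u x \<le> t \<and> t < v x} \<partial>lborel)" by (simp add: 2)
  have "(\<lambda>t. \<integral>\<^sup>+x. f (x, t) \<partial>N) \<in> borel_measurable lborel" by measurable
  then show "(\<lambda>t. emeasure M {x \<in> space M. u x \<le> t \<and> t < v x}) \<in> borel_measurable lborel"
    by (simp add: 2)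
qed

section \<open>Enlargements of superlevel sets and suprema over balls\<close>

lemma enlargement_eq: "enlargement A h = {x. \<exists>y\<in>A. dist x y < h}"
proof (cases "A = {}")
  case False
  have "infdist x A < h \<longleftrightarrow> (\<exists>y\<in>A. dist x y < h)" for x
    unfolding infdist_notempty[OF False] using False
    by (intro cINF_less_iff) (auto intro!: bdd_belowI[of _ 0])
  with False show ?thesis by (simp add: enlargement_def)
qed (simp add: enlargement_def)

lemma enlargement_mono: "A \<subseteq> B \<Longrightarrow> h \<le> k \<Longrightarrow> enlargement A h \<subseteq> enlargement B k"
  by (force simp: enlargement_eq)

lemma open_enlargement: "open (enlargement A h)"
proof -
  have "enlargement A h = (\<Union>y\<in>A. ball y h)"
    by (auto simp: enlargement_eq dist_commute)
  then show ?thesis by auto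
qed

text \<open>The upper envelope of \<open>g\<close> at scale \<open>h\<close>. Open balls match the
  strict inequality in \<open>enlargement\<close>, so its superlevel sets are exactly the enlarged
  superlevel sets of \<open>g\<close>.\<close>

definition ball_sup :: "real \<Rightarrow> ('a::metric_space \<Rightarrow> real) \<Rightarrow> 'a \<Rightarrow> real" where
  "ball_sup h g x = (SUP y\<in>ball x h. g y)"

context
  fixes g :: "'a::metric_space \<Rightarrow> real" and L h :: real
  assumes lip: "L-lipschitz_on UNIV g" and h: "0 < h"
begin

lemma le_ball_bound:
  assumes "dist x y < h" shows "g y \<le> g x + L * h"
proof -
  have "\<bar>g x - g y\<bar> \<le> L * dist x y"
    using lipschitz_onD[OF lip, of x y] by (simp add: dist_real_def)
  also have "\<dots> \<le> L * h"
    using assms lipschitz_on_nonneg[OF lip] by (intro mult_left_mono) auto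
  finally show ?thesis by linarith
qed

lemma bdd_above_ball: "bdd_above (g ` ball x h)"
  by (rule bdd_aboveI[of _ "g x + L * h"]) (auto intro: le_ball_bound)

lemma ball_sup_le: "ball_sup h g x \<le> g x + L * h"
  unfolding ball_sup_def using h by (intro cSUP_least) (auto intro: le_ball_bound)

lemma ball_sup_ge: "g x \<le> ball_sup h g x"
  unfolding ball_sup_def using h by (intro cSUP_upper bdd_above_ball) auto

lemma less_ball_sup_set: "{x. t < ball_sup h g x} = enlargement {x. t < g x} h"
proof -
  have "t < ball_sup h g x \<longleftrightarrow> (\<exists>y\<in>ball x h. t < g y)" for x
    unfolding ball_sup_def using h by (intro less_cSUP_iff bdd_above_ball) auto
  then show ?thesis by (auto simp: enlargement_eq)
qed

lemma borel_measurable_ball_sup: "ball_sup h g \<in> borel_measurable borel"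
  by (rule borel_measurableI_greater) (simp add: less_ball_sup_set open_enlargement)

end

text \<open>A bound \<open>q\<close> on the slopes from \<open>x\<close> to all points closer than
  \<open>d\<close> bounds \<open>g\<close> by \<open>g x + q * h n\<close> on the ball of radius
  \<open>h n < d\<close>, and this bound passes to the supremum.\<close>

lemma limsup_ball_sup_le_grad_modulus:
  fixes h :: "nat \<Rightarrow> real"
  assumes h: "\<And>n. 0 < h n" and h0: "h \<longlonglongrightarrow> 0"
  shows "limsup (\<lambda>n. ennreal ((ball_sup (h n) g x - g x) / h n)) \<le> grad_modulus g x"
  unfolding Limsup_le_iff
proof safe
  fix c assume "grad_modulus g x < c"
  \<comment> \<open>The intermediate \<open>c'\<close> is finite, hence a real slope
    \<open>q\<close>, and restores the strict inequality that the supremum over the ball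
    loses.\<close>
  then obtain c' where c': "grad_modulus g x < c'" "c' < c" using dense by blast
  then obtain q where q: "c' = ennreal q" "0 \<le> q"
    by (cases c') auto
  have "eventually (\<lambda>y. ennreal (\<bar>g x - g y\<bar> / dist x y) < c') (at x)"
    using c'(1) unfolding grad_modulus_def by (rule Limsup_lessD)
  then obtain d where d: "0 < d"
    "\<And>y. y \<noteq> x \<Longrightarrow> dist y x < d \<Longrightarrow> ennreal (\<bar>g x - g y\<bar> / dist x y) < c'"
    unfolding eventually_at by auto
  have "eventually (\<lambda>n. h n < d) sequentially"
    using h0 d(1) by (rule order_tendstoD)
  then show "eventually (\<lambda>n. ennreal ((ball_sup (h n) g x - g x) / h n) < c) sequentially"
  proof eventually_elim
    case (elim n)
    have "g y \<le> g x + q * h n" if "y \<in> ball x (h n)" for y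
    proof (cases "y = x")
      case False
      have "\<bar>g x - g y\<bar> / dist x y < q"
        using d(2)[OF False] that elim q by (simp add: dist_commute ennreal_less_iff)
      then have "\<bar>g x - g y\<bar> < q * dist x y"
        using False by (simp add: divide_less_eq)
      also have "\<dots> \<le> q * h n" using that q by (intro mult_left_mono) auto
      finally show ?thesis by linarith
    qed (use q h[of n] in simp)
    then have "ball_sup (h n) g x \<le> g x + q * h n"
      unfolding ball_sup_def using h[of n] by (intro cSUP_least) auto
    then have "(ball_sup (h n) g x - g x) / h n \<le> q"
      using h[of n] by (simp add: divide_le_eq)
    then have "ennreal ((ball_sup (h n) g x - g x) / h n) \<le> c'"
      using q by (simp add: ennreal_leI)
    then show ?case using c'(2) by order
  qed
qed


section \<open>Coarea inequality\<close>

text \<open>Replaces the continuous parameter by a sequence, as Fatou's lemma requires; passing to a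
  sequence can only raise the lower limit.\<close>

lemma boundary_measure_le_liminf:
  assumes h: "\<And>n. 0 < h n" and h0: "h \<longlonglongrightarrow> 0"
  shows "boundary_measure M A \<le>
    liminf (\<lambda>n. (emeasure M (enlargement A (h n)) - emeasure M A) / ennreal (h n))"
proof -
  have lim: "filterlim h (at_right 0) sequentially"
    using h h0 by (auto simp: filterlim_at less_imp_neq[symmetric])
  show ?thesis
    unfolding boundary_measure_def Liminf_def[of "at_right 0"]
  proof (intro SUP_least Liminf_bounded)
    fix P :: "real \<Rightarrow> bool" assume "P \<in> {P. eventually P (at_right 0)}"
    then have "\<forall>\<^sub>F n in sequentially. P (h n)"
      using lim by (auto simp: filterlim_iff)
    then show "\<forall>\<^sub>F n in sequentially.
      (INF x\<in>Collect P. (emeasure M (enlargement A x) - emeasure M A) / ennreal x)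
        \<le> (emeasure M (enlargement A (h n)) - emeasure M A) / ennreal (h n)"
      by eventually_elim (auto intro: INF_lower)
  qed
qed

text \<open>The difference quotient of \<open>ball_sup h g\<close> over \<open>g\<close> integrates, by the layer-cake formula, to
  the Minkowski difference quotients of the superlevel sets; Fatou on one side and reverse Fatou
  (with majorant \<open>L\<close> on the enlarged support) on the other give the coarea inequality. The
  constant \<open>c\<close> is inside since the integrand need not be measurable.\<close>

lemma coarea_inequality:
  fixes g :: "'a::metric_space \<Rightarrow> real"
  assumes sets: "sets M = sets borel" and lip: "L-lipschitz_on UNIV g" and nn: "\<And>x. 0 \<le> g x"
    and h0: "0 < h0" and fin: "emeasure M (enlargement {x. 0 < g x} h0) < \<infinity>"
  shows "(\<integral>\<^sup>+t. c * boundary_measure M {x. t < g x} * indicator {0..} t \<partial>lborel)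
    \<le> c * (\<integral>\<^sup>+x. grad_modulus g x \<partial>M)"
proof -
  have sp: "space M = UNIV" using sets_eq_imp_space_eq[OF sets] by simp
  note [measurable_cong] = sets
  define U where "U = enlargement {x. 0 < g x} h0"
  have [measurable]: "U \<in> sets M" unfolding U_def sets by (intro borel_open open_enlargement)
  have finU: "emeasure M U < \<infinity>" using fin by (simp add: U_def)
  \<comment> \<open>All scales stay at or below \<open>h0\<close>, so every enlargement of
    \<open>{x. 0 < g x}\<close> lies in the one set \<open>U\<close> of finite measure.\<close>
  define h where "h n = h0 / real (Suc n)" for n
  have h: "0 < h n" "h n \<le> h0" for n
    using h0 by (auto simp: h_def divide_le_eq mult_le_cancel_left1)
  have hlim: "h \<longlonglongrightarrow> 0"
    unfolding h_def using tendsto_mult_right_zero[OF LIMSEQ_inverse_real_of_nat, of h0]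
    by (simp add: divide_inverse)
  have gm[measurable]: "g \<in> borel_measurable M"
    using lipschitz_on_continuous_on[OF lip]
    by (simp add: measurable_cong_sets[OF sets refl] borel_measurable_continuous_onI)
  define b where "b n = ball_sup (h n) g" for n
  have bm[measurable]: "b n \<in> borel_measurable M" for n
    using borel_measurable_ball_sup[OF lip h(1)]
    by (simp add: b_def measurable_cong_sets[OF sets refl])
  have bge: "g x \<le> b n x" for n x unfolding b_def by (rule ball_sup_ge[OF lip h(1)])
  have ble: "b n x \<le> g x + L * h n" for n x unfolding b_def by (rule ball_sup_le[OF lip h(1)])
  have set_b: "{x. t < b n x} = enlargement {x. t < g x} (h n)" for n t
    unfolding b_def by (rule less_ball_sup_set[OF lip h(1)])
  \<comment> \<open>Off \<open>U\<close> no point within \<open>h n\<close> has positive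
    \<open>g\<close>, so \<open>0 \<le> g x \<le> b n x \<le> 0\<close>.\<close>
  have off: "g x = b n x" if "x \<notin> U" for n x
  proof -
    have "x \<notin> {x. 0 < b n x}"
      unfolding set_b using that enlargement_mono[OF order_refl h(2)] by (auto simp: U_def)
    then show ?thesis using bge[of x n] nn[of x] by auto
  qed
  \<comment> \<open>For \<open>t \<ge> 0\<close> this is the Minkowski difference quotient of
    \<open>{x. t < g x}\<close> at scale \<open>h n\<close>; for \<open>t < 0\<close> it is 0
    because \<open>g \<ge> 0\<close>.\<close>
  define D where "D n t = emeasure M {x \<in> space M. g x \<le> t \<and> t < b n x} / ennreal (h n)" for n t
  have [measurable]: "D n \<in> borel_measurable lborel" for n
    unfolding D_def
    by (intro borel_measurable_divide_ennreal borel_measurable_const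
      borel_measurable_emeasure_between[OF _ _ \<open>U \<in> sets M\<close> finU] bge off) measurable
  have boundary: "boundary_measure M {x. t < g x} \<le> liminf (\<lambda>n. D n t)" if "0 \<le> t" for t
  proof -
    \<comment> \<open>Finite measure of the level set turns the difference of measures into the
      measure of a set difference.\<close>
    have "{x. t < g x} \<subseteq> U"
    proof
      fix x assume "x \<in> {x. t < g x}"
      then show "x \<in> U" unfolding U_def enlargement_eq
        using that h0 by (auto intro!: exI[of _ x])
    qed
    then have "emeasure M {x. t < g x} \<le> emeasure M U" by (intro emeasure_mono) auto
    then have f: "emeasure M {x. t < g x} \<noteq> \<infinity>" using finU by auto
    have "emeasure M (enlargement {x. t < g x} (h n)) - emeasure M {x. t < g x} =
      emeasure M {x \<in> space M. g x \<le> t \<and> t < b n x}" for n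
    proof -
      have "{x. t < b n x} - {x. t < g x} = {x \<in> space M. g x \<le> t \<and> t < b n x}"
        by (auto simp: sp)
      moreover have "{x. t < g x} \<in> sets M" "{x. t < b n x} \<in> sets M"
        using measurable_sets[OF gm, of "{t<..}"] measurable_sets[OF bm, of "{t<..}" n]
        by (auto simp: sp vimage_def)
      ultimately show ?thesis
        using f bge by (subst emeasure_Diff[symmetric]) (auto simp: set_b[symmetric] intro: order_less_le_trans)
    qed
    then show ?thesis
      using boundary_measure_le_liminf[of h M "{x. t < g x}"] h hlim by (simp add: D_def)
  qed
  have intD: "(\<integral>\<^sup>+t. D n t \<partial>lborel) = (\<integral>\<^sup>+x. ennreal ((b n x - g x) / h n) \<partial>M)" for n
  proof -
    have "(\<integral>\<^sup>+t. D n t \<partial>lborel) =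
      (\<integral>\<^sup>+t. emeasure M {x \<in> space M. g x \<le> t \<and> t < b n x} \<partial>lborel) / ennreal (h n)"
      unfolding D_def
      by (intro nn_integral_divide borel_measurable_emeasure_between[OF _ _ \<open>U \<in> sets M\<close> finU] bge off)
         measurable
    also have "\<dots> = (\<integral>\<^sup>+x. ennreal (b n x - g x) \<partial>M) / ennreal (h n)"
      by (subst nn_integral_diff_eq_layer_cake[OF _ _ \<open>U \<in> sets M\<close> finU bge off]) auto
    also have "\<dots> = (\<integral>\<^sup>+x. ennreal (b n x - g x) / ennreal (h n) \<partial>M)"
      by (rule nn_integral_divide[symmetric]) measurable
    finally show ?thesis using bge h by (simp add: divide_ennreal)
  qed
  have bound: "ennreal ((b n x - g x) / h n) \<le> ennreal L * indicator U x" for n x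
  proof (cases "x \<in> U")
    case True
    have "(b n x - g x) / h n \<le> L"
      using ble[of n x] h(1)[of n] by (simp add: divide_le_eq)
    then show ?thesis using True by (simp add: ennreal_leI)
  qed (use off[of x n] in simp)
  have "(\<integral>\<^sup>+t. c * boundary_measure M {x. t < g x} * indicator {0..} t \<partial>lborel)
    \<le> (\<integral>\<^sup>+t. c * liminf (\<lambda>n. D n t) \<partial>lborel)"
    using boundary by (intro nn_integral_mono) (auto simp: indicator_def intro!: mult_left_mono)
  also have "\<dots> = c * (\<integral>\<^sup>+t. liminf (\<lambda>n. D n t) \<partial>lborel)"
    by (rule nn_integral_cmult) measurable
  also have "\<dots> \<le> c * liminf (\<lambda>n. \<integral>\<^sup>+t. D n t \<partial>lborel)"
    by (intro mult_left_mono nn_integral_liminf) auto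
  also have "\<dots> \<le> c * limsup (\<lambda>n. \<integral>\<^sup>+x. ennreal ((b n x - g x) / h n) \<partial>M)"
    unfolding intD by (intro mult_left_mono Liminf_le_Limsup) auto
  also have "\<dots> \<le> c * (\<integral>\<^sup>+x. limsup (\<lambda>n. ennreal ((b n x - g x) / h n)) \<partial>M)"
    using finU
    by (intro mult_left_mono nn_integral_limsup[where w = "\<lambda>x. ennreal L * indicator U x"] AE_I2 bound)
       (auto simp: nn_integral_cmult_indicator ennreal_mult_less_top)
  also have "\<dots> \<le> c * (\<integral>\<^sup>+x. grad_modulus g x \<partial>M)"
    unfolding b_def
    by (intro mult_left_mono nn_integral_mono limsup_ball_sup_le_grad_modulus h hlim) auto
  finally show ?thesis .
qed

section \<open>Monotonicity of the profile and of its quotient\<close>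

context isoperimetric_space
begin

abbreviation I :: "real \<Rightarrow> ennreal" where "I \<equiv> isoperimetric_profile M"

lemma space_eq: "space M = UNIV"
  using sets_eq_imp_space_eq[OF sets_eq_borel] by simp

lemma profile_domain_downward: "t \<in> profile_domain M \<Longrightarrow> 0 \<le> s \<Longrightarrow> s \<le> t \<Longrightarrow> s \<in> profile_domain M"
  unfolding profile_domain_def by (auto intro: le_less_trans ennreal_leI)

lemma ennreal_enn2real_profile: "t \<in> profile_domain M \<Longrightarrow> ennreal (enn2real (I t)) = I t"
  using profile_finite by (simp add: ennreal_enn2real_if less_top)

lemma enn2real_profile_pos: "t \<in> profile_domain M \<Longrightarrow> 0 < t \<Longrightarrow> 0 < enn2real (I t)"
  using profile_finite profile_pos by (simp add: enn2real_positive_iff less_top)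

lemma ennreal_quotient_profile:
  assumes "t \<in> profile_domain M" "0 < t"
  shows "ennreal t / I t = ennreal (t / enn2real (I t))"
  using divide_ennreal[of t "enn2real (I t)"] enn2real_profile_pos[OF assms] assms
  by (simp add: ennreal_enn2real_profile)

text \<open>Concavity on the segment from 0 to \<open>t\<close>, with \<open>I 0 = 0\<close>, gives
  \<open>I s \<ge> (s / t) * I t\<close>.\<close>

lemma profile_quotient_mono:
  assumes t: "t \<in> profile_domain M" and s: "0 < s" "s \<le> t"
  shows "ennreal s / I s \<le> ennreal t / I t"
proof -
  have sd: "s \<in> profile_domain M" using t s by (auto intro: profile_domain_downward)
  have 0: "0 \<in> profile_domain M" using t s by (auto intro: profile_domain_downward)
  let ?l = "s / t"
  have "(1 - ?l) * enn2real (I 0) + ?l * enn2real (I t) \<le> enn2real (I ((1 - ?l) *\<^sub>R 0 + ?l *\<^sub>R t))"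
    using s by (intro concave_onD[OF profile_concave _ _ 0 t]) auto
  then have "s * enn2real (I t) \<le> enn2real (I s) * t"
    using s by (simp add: profile_0 field_simps)
  then have "s / enn2real (I s) \<le> t / enn2real (I t)"
    using enn2real_profile_pos[OF sd s(1)] enn2real_profile_pos[OF t] s by (simp add: field_simps)
  moreover have "0 < t" using s by simp
  ultimately show ?thesis
    using ennreal_quotient_profile[OF sd s(1)] ennreal_quotient_profile[OF t]
    by (simp add: ennreal_leI)
qed

text \<open>For finite total mass \<open>m\<close>, the point \<open>t\<close> lies between
  \<open>s\<close> and its mirror image \<open>m - s\<close>, where \<open>I\<close> takes the same
  value; concavity then forces \<open>I t \<ge> I s\<close>.\<close>

lemma profile_mono_upto_half:
  assumes s: "0 < s" "s \<le> t" and t: "ennreal t \<le> emeasure M (space M) / 2"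
  shows "I s \<le> I t"
proof (cases "emeasure M (space M) = \<infinity>")
  case True
  then show ?thesis using profile_increasing s by (auto simp: mono_on_def)
next
  case False
  define m where "m = measure M (space M)"
  have m: "emeasure M (space M) = ennreal m"
    using False by (simp add: m_def emeasure_eq_ennreal_measure)
  have "emeasure M (space M) / 2 = ennreal (m / 2)"
    by (simp add: m m_def divide_ennreal[symmetric])
  then have tm: "t \<le> m / 2" using t s by (simp add: m_def)
  have dom: "profile_domain M = {0..<m}"
    by (auto simp: profile_domain_def m ennreal_less_iff)
  have sym: "I (m - s) = I s"
    unfolding m_def using False tm s by (intro profile_symmetric) (auto simp: m_def less_top)
  have d: "s \<in> profile_domain M" "m - s \<in> profile_domain M" "t \<in> profile_domain M"
    using s tm by (auto simp: dom)
  have "enn2real (I s) \<le> enn2real (I t)"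
  \<comment> \<open>Here \<open>s = m / 2\<close>, hence \<open>t = s\<close>; otherwise
    \<open>m - 2 * s > 0\<close> can serve as denominator.\<close>
  proof (cases "m - s = s")
    case True
    then show ?thesis using s tm by (auto simp: field_simps)
  next
    case False
    let ?l = "(t - s) / (m - 2 * s)"
    have pos: "0 < m - 2 * s" using s tm False by auto
    have eq: "(1 - ?l) *\<^sub>R s + ?l *\<^sub>R (m - s) = t"
    proof -
      have "(1 - ?l) *\<^sub>R s + ?l *\<^sub>R (m - s) = s + ?l * (m - 2 * s)"
        by (simp only: real_scaleR_def ring_distribs left_diff_distrib right_diff_distrib) algebra
      then show ?thesis using pos by simp
    qed
    have "0 \<le> ?l" "?l \<le> 1" using pos s tm by auto
    from concave_onD[OF profile_concave this d(1,2)]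
    have "(1 - ?l) * enn2real (I s) + ?l * enn2real (I (m - s)) \<le> enn2real (I t)"
      unfolding eq .
    then show ?thesis unfolding sym by (simp add: algebra_simps)
  qed
  then have "ennreal (enn2real (I s)) \<le> ennreal (enn2real (I t))" by (rule ennreal_leI)
  then show ?thesis using d by (simp add: ennreal_enn2real_profile)
qed

lemma profile_quotient_ennreal: "0 < t \<Longrightarrow> profile_quotient M (ennreal t) = ennreal t / I t"
  by (simp add: profile_quotient_def)

text \<open>Monotonicity makes the limit at infinity exist and equal the supremum over all positive
  arguments.\<close>

lemma quotient_le_profile_quotient_top:
  assumes "emeasure M (space M) = \<infinity>" "0 < s"
  shows "ennreal s / I s \<le> profile_quotient M \<infinity>"
proof -
  let ?q = "\<lambda>s. ennreal s / I s"
  have dom: "t \<in> profile_domain M" if "0 < t" for t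
    using that assms by (simp add: profile_domain_def)
  have mono: "?q s \<le> ?q t" if "0 < s" "s \<le> t" for s t
    using that dom by (intro profile_quotient_mono) auto
  have "(?q \<longlongrightarrow> (SUP t\<in>{0<..}. ?q t)) at_top"
  proof (rule increasing_tendsto)
    show "\<forall>\<^sub>F t in at_top. ?q t \<le> (SUP t\<in>{0<..}. ?q t)"
      using eventually_gt_at_top[of 0] by eventually_elim (auto intro: SUP_upper)
    fix c assume "c < (SUP t\<in>{0<..}. ?q t)"
    then obtain u where "0 < u" "c < ?q u" by (auto simp: less_SUP_iff)
    then have "c < ?q t" if "u \<le> t" for t
      using mono[OF \<open>0 < u\<close> that] \<open>c < ?q u\<close> by order
    then show "\<forall>\<^sub>F t in at_top. c < ?q t"
      by (rule eventually_mono[OF eventually_ge_at_top[of u]])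
  qed
  then have "Lim at_top ?q = (SUP t\<in>{0<..}. ?q t)"
    by (intro tendsto_Lim) auto
  then show ?thesis
    using assms(2) by (auto simp: profile_quotient_def intro: SUP_upper)
qed

text \<open>The pointwise estimate behind the layer-cake argument, with \<open>a\<close> the mass of
  \<open>{w \<le> r}\<close> and \<open>s\<close> that of a level set. With
  \<open>b = min a (m / 2)\<close>: for \<open>s \<le> b\<close> write
  \<open>s = (s / I s) * I s\<close> and enlarge the quotient; for \<open>s > b\<close> write
  \<open>b = (b / I b) * I b\<close> and enlarge \<open>I b\<close> to \<open>I s\<close>.\<close>

lemma min_le_profile_quotient_mult:
  assumes s: "ennreal s \<le> emeasure M (space M) / 2"
  shows "min a (ennreal s) \<le> profile_quotient M (min a (emeasure M (space M) / 2)) * I s"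
proof (cases "a = 0 \<or> s \<le> 0")
  case True
  then show ?thesis by (auto simp: ennreal_neg)
next
  case False
  then have pos: "0 < a" "0 < s" by (auto simp: zero_less_iff_neq_zero)
  let ?m = "emeasure M (space M)"
  \<comment> \<open>The domain excludes the total mass; for finite mass, positivity of
    \<open>t\<close> makes \<open>t \<le> m / 2\<close> strictly less than \<open>m\<close>.\<close>
  have half: "ennreal t \<in> {0..?m / 2} \<Longrightarrow> 0 < t \<Longrightarrow> t \<in> profile_domain M" for t
  proof -
    assume t: "ennreal t \<in> {0..?m / 2}" "0 < t"
    show "t \<in> profile_domain M"
    proof (cases "?m = \<infinity>")
      case True then show ?thesis using t by (simp add: profile_domain_def)
    next
      case False
      then obtain m where m: "?m = ennreal m" "0 \<le> m" by (cases ?m) auto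
      then have "?m / 2 = ennreal (m / 2)" by (simp add: divide_ennreal[symmetric])
      then show ?thesis using t m by (auto simp: profile_domain_def ennreal_less_iff)
    qed
  qed
  have sd: "s \<in> profile_domain M" using s pos half by auto
  have cancel: "x / I t * I t = x" if "t \<in> profile_domain M" "0 < t" for x t
    using profile_pos[OF that] profile_finite[OF that(1)]
    by (simp add: ennreal_divide_times ennreal_times_divide ennreal_mult_divide_eq)
  let ?b = "min a (?m / 2)"
  show ?thesis
  proof (cases ?b)
    \<comment> \<open>An infinite minimum forces infinite total mass, so the quotient is the limit
      value, which dominates \<open>s / I s\<close>.\<close>
    case top
    then have "?m / 2 = top" by (auto simp: min_def top_unique split: if_splits)
    moreover have "ennreal x / 2 < top" for x
      by (cases "0 \<le> x") (auto simp: ennreal_divide_numeral ennreal_neg)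
    ultimately have "?m = \<infinity>" by (metis ennreal_cases less_irrefl infinity_ennreal_def)
    then have "ennreal s / I s * I s \<le> profile_quotient M ?b * I s"
      unfolding top using quotient_le_profile_quotient_top pos by (intro mult_right_mono) auto
    then show ?thesis by (simp add: cancel sd pos min.coboundedI2)
  next
    case (real b)
    have "0 < ennreal s" using pos by simp
    then have "0 < ?m / 2" using s by (rule less_le_trans)
    then have "0 < ?b" using pos by simp
    then have "0 < ennreal b" unfolding real(2) .
    then have b: "0 < b" by simp
    have b_half: "ennreal b \<le> ?m / 2" unfolding real(2)[symmetric] by simp
    have bd: "b \<in> profile_domain M" using b b_half half by simp
    show ?thesis
    proof (cases "s \<le> b")
      case True
      have "ennreal s / I s * I s \<le> ennreal b / I b * I s"
        using True pos bd by (intro mult_right_mono profile_quotient_mono) auto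
      then show ?thesis
        unfolding real(2) using b by (auto simp: profile_quotient_ennreal cancel sd pos intro: order_trans[OF min.cobounded2])
    next
      case False
      have "min a (ennreal s) \<le> ?b" using s by (auto simp: min_def)
      also have "\<dots> = ennreal b / I b * I b" using b by (simp add: real(2) cancel bd)
      also have "\<dots> \<le> ennreal b / I b * I s"
        using b False s by (intro mult_left_mono profile_mono_upto_half) auto
      finally show ?thesis using b by (simp add: real(2) profile_quotient_ennreal)
    qed
  qed
qed

end


section \<open>The inequality for nonnegative functions positive on at most half of the
  space\<close>

lemma grad_modulus_mono:
  assumes "\<And>x y. \<bar>g x - g y\<bar> \<le> \<bar>f x - f y\<bar>"
  shows "grad_modulus g x \<le> grad_modulus f x"
  unfolding grad_modulus_def
  by (intro Limsup_mono always_eventually allI ennreal_leI divide_right_mono assms) auto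

lemma lipschitz_on_mono_diff:
  fixes f g :: "'a::metric_space \<Rightarrow> real"
  assumes "L-lipschitz_on UNIV f" "\<And>x y. \<bar>g x - g y\<bar> \<le> \<bar>f x - f y\<bar>"
  shows "L-lipschitz_on UNIV g"
  using assms unfolding lipschitz_on_def dist_real_def by (blast intro: order_trans)

context isoperimetric_space
begin

lemma profile_le_boundary_measure:
  assumes "A \<in> sets M" "emeasure M A < \<infinity>"
  shows "I (measure M A) \<le> boundary_measure M A"
  unfolding isoperimetric_profile_def using assms
  by (intro INF_lower) (auto simp: emeasure_eq_ennreal_measure)

lemma borel_measurable_lipschitz: "L-lipschitz_on UNIV g \<Longrightarrow> g \<in> borel_measurable M"
  for g :: "'a \<Rightarrow> real"
  using borel_measurable_continuous_onI[OF lipschitz_on_continuous_on]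
  by (simp add: measurable_cong_sets[OF sets_eq_borel refl])

text \<open>This is \<open>b / I b \<le> C(w) r\<close>: one term of the defining supremum, cleared
  of its factor \<open>1 / r\<close>.\<close>

lemma profile_quotient_le_weight_constant:
  assumes "0 < r"
  shows "profile_quotient M (min (emeasure M {x \<in> space M. w x \<le> r}) (emeasure M (space M) / 2))
    \<le> weight_constant M w * ennreal r" (is "?q \<le> _")
proof -
  have "ennreal (1 / r) * ?q \<le> weight_constant M w"
    unfolding weight_constant_def using assms by (auto intro: SUP_upper2[of r])
  then have "ennreal (1 / r) * ?q * ennreal r \<le> weight_constant M w * ennreal r"
    by (rule mult_right_mono) auto
  moreover have "ennreal (1 / r) * ?q * ennreal r = ennreal (1 / r * r) * ?q"
    using assms by (simp only: ennreal_mult' mult_ac)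
  ultimately show ?thesis using assms by simp
qed

lemma weighted_inequality_support:
  assumes w: "w \<in> borel_measurable M" and r: "0 < r" and \<alpha>: "0 < \<alpha>"
    and lip: "L-lipschitz_on UNIV g" and nn: "\<And>x. 0 \<le> g x"
    and h: "0 < h" and fin: "emeasure M (enlargement {x. 0 < g x} h) < \<infinity>"
    and half: "emeasure M {x. 0 < g x} \<le> emeasure M (space M) / 2"
  shows "(\<integral>\<^sup>+x. ennreal (g x) \<partial>M) \<le>
    weight_constant M w * ennreal r * (\<integral>\<^sup>+x. grad_modulus g x \<partial>M)
      + ennreal (r powr (- \<alpha>)) * (\<integral>\<^sup>+x. ennreal (w x powr \<alpha> * g x) \<partial>M)"
proof -
  note [measurable] = w
  have gm[measurable]: "g \<in> borel_measurable M" using lip by (rule borel_measurable_lipschitz)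
  define A where "A = {x \<in> space M. w x \<le> r}"
  have [measurable]: "A \<in> sets M" by (simp add: A_def)
  define q where "q = profile_quotient M (min (emeasure M A) (emeasure M (space M) / 2))"
  have level[measurable]: "{x. t < g x} \<in> sets M" for t
    using measurable_sets[OF gm, of "{t<..}"] by (simp add: vimage_def space_eq greaterThan_def)
  have sub: "{x. 0 < g x} \<subseteq> enlargement {x. 0 < g x} h"
    unfolding enlargement_eq using h by (auto intro!: exI)
  have fin0: "emeasure M {x. 0 < g x} < \<infinity>"
    using emeasure_mono[OF sub, of M] fin
    by (auto simp: sets_eq_borel borel_open open_enlargement intro: le_less_trans)
  \<comment> \<open>The set lies in both \<open>A\<close> and \<open>{x. t < g x}\<close>, so its
    mass is at most the minimum of theirs; for \<open>t < 0\<close> it is empty.\<close>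
  have level_bound: "emeasure M {x \<in> space M. 0 \<le> t \<and> t < g x * indicator A x} \<le>
      q * boundary_measure M {x. t < g x} * indicator {0..} t" (is "emeasure M ?S \<le> _") for t
  proof (cases "0 \<le> t")
    case True
    have mono0: "emeasure M {x. t < g x} \<le> emeasure M {x. 0 < g x}"
      using True by (intro emeasure_mono level) auto
    have fint: "emeasure M {x. t < g x} < \<infinity>" using mono0 fin0 by order
    define s where "s = measure M {x. t < g x}"
    have s: "emeasure M {x. t < g x} = ennreal s"
      unfolding s_def using fint by (intro emeasure_eq_ennreal_measure) auto
    have "?S \<subseteq> A" "?S \<subseteq> {x. t < g x}"
      using True by (auto simp: indicator_def split: if_splits)
    then have "emeasure M ?S \<le> min (emeasure M A) (ennreal s)"
      unfolding s[symmetric] min.bounded_iff by (intro conjI emeasure_mono) auto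
    also have "\<dots> \<le> q * I s"
      unfolding q_def using mono0 half
      by (intro min_le_profile_quotient_mult) (auto simp flip: s)
    also have "\<dots> \<le> q * boundary_measure M {x. t < g x}"
      unfolding s_def by (intro mult_left_mono profile_le_boundary_measure level fint) auto
    finally show ?thesis using True by simp
  qed simp
  \<comment> \<open>Layer cake with lower graph 0 and \<open>{x. 0 < g x}\<close> as the set of
    finite measure.\<close>
  have "(\<integral>\<^sup>+x. ennreal (g x * indicator A x - 0) \<partial>M)
      = (\<integral>\<^sup>+t. emeasure M {x \<in> space M. 0 \<le> t \<and> t < g x * indicator A x} \<partial>lborel)"
    by (rule nn_integral_diff_eq_layer_cake[OF _ _ level[of 0] fin0])
       (use nn in \<open>auto simp: indicator_def not_less intro: antisym\<close>)
  also have "\<dots> \<le> (\<integral>\<^sup>+t. q * boundary_measure M {x. t < g x} * indicator {0..} t \<partial>lborel)"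
    by (intro nn_integral_mono level_bound)
  also have "\<dots> \<le> q * (\<integral>\<^sup>+x. grad_modulus g x \<partial>M)"
    by (rule coarea_inequality[OF sets_eq_borel lip nn h fin])
  also have "\<dots> \<le> weight_constant M w * ennreal r * (\<integral>\<^sup>+x. grad_modulus g x \<partial>M)"
    unfolding q_def A_def by (intro mult_right_mono profile_quotient_le_weight_constant r) auto
  finally have inside: "(\<integral>\<^sup>+x. ennreal (g x * indicator A x) \<partial>M) \<le> \<dots>" by simp
  have outside: "ennreal (g x * indicator (space M - A) x) \<le>
      ennreal (r powr (- \<alpha>)) * ennreal (w x powr \<alpha> * g x)" for x
  proof (cases "r < w x")
    case True
    have "r powr \<alpha> \<le> w x powr \<alpha>" using True r \<alpha> by (intro powr_mono2) auto
    then have "1 \<le> r powr (- \<alpha>) * w x powr \<alpha>"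
      using r by (simp add: powr_minus field_simps)
    then have "1 * g x \<le> r powr (- \<alpha>) * w x powr \<alpha> * g x" by (intro mult_right_mono nn)
    then have "g x * indicator (space M - A) x \<le> r powr (- \<alpha>) * (w x powr \<alpha> * g x)"
      using nn[of x] by (auto simp: indicator_def mult_ac)
    then show ?thesis by (simp add: ennreal_leI flip: ennreal_mult')
  qed (simp add: A_def space_eq)
  have "(\<integral>\<^sup>+x. ennreal (g x) \<partial>M) =
      (\<integral>\<^sup>+x. ennreal (g x * indicator A x) + ennreal (g x * indicator (space M - A) x) \<partial>M)"
    by (intro nn_integral_cong) (auto simp: indicator_def)
  also have "\<dots> = (\<integral>\<^sup>+x. ennreal (g x * indicator A x) \<partial>M) +
      (\<integral>\<^sup>+x. ennreal (g x * indicator (space M - A) x) \<partial>M)"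
    by (rule nn_integral_add) measurable
  also have "\<dots> \<le> (\<integral>\<^sup>+x. ennreal (g x * indicator A x) \<partial>M) +
      (\<integral>\<^sup>+x. ennreal (r powr (- \<alpha>)) * ennreal (w x powr \<alpha> * g x) \<partial>M)"
    by (intro add_left_mono nn_integral_mono outside)
  also have "(\<integral>\<^sup>+x. ennreal (r powr (- \<alpha>)) * ennreal (w x powr \<alpha> * g x) \<partial>M) =
      ennreal (r powr (- \<alpha>)) * (\<integral>\<^sup>+x. ennreal (w x powr \<alpha> * g x) \<partial>M)"
    by (rule nn_integral_cmult) measurable
  finally show ?thesis using inside by (meson add_right_mono order_trans)
qed

text \<open>Lets \<open>g\<close> be a positive part, a negative part or a truncation of
  \<open>f\<close>, while the gradient term stays that of \<open>f\<close>.\<close>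

lemma weighted_inequality_contraction:
  assumes w: "w \<in> borel_measurable M" and r: "0 < r" and \<alpha>: "0 < \<alpha>"
    and lip: "L-lipschitz_on UNIV f" and nn: "\<And>x. 0 \<le> g x"
    and contr: "\<And>x y. \<bar>g x - g y\<bar> \<le> \<bar>f x - f y\<bar>"
    and h: "0 < h" and fin: "emeasure M (enlargement {x. 0 < g x} h) < \<infinity>"
    and half: "emeasure M {x. 0 < g x} \<le> emeasure M (space M) / 2"
  shows "(\<integral>\<^sup>+x. ennreal (g x) \<partial>M) \<le>
    weight_constant M w * ennreal r * (\<integral>\<^sup>+x. grad_modulus f x \<partial>M)
      + ennreal (r powr (- \<alpha>)) * (\<integral>\<^sup>+x. ennreal (w x powr \<alpha> * g x) \<partial>M)"
  by (rule order_trans[OF weighted_inequality_support[OF w r \<alpha> lipschitz_on_mono_diff[OF lip contr] nn h fin half]])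
     (intro add_right_mono mult_left_mono nn_integral_mono grad_modulus_mono contr zero_le)

section \<open>Passage to functions of either sign, for finite and for infinite total
  measure\<close>

text \<open>The factor 2 has two sources: for median 0 the estimates of both parts are added, each
  with the full gradient term of \<open>f\<close>; for mean 0 the estimate of a single part is
  doubled.\<close>

lemma weighted_inequality_finite:
  assumes w: "w \<in> borel_measurable M" and r: "0 < r" and \<alpha>: "0 < \<alpha>"
    and fin: "emeasure M (space M) < \<infinity>" and f: "f \<in> Lip"
    and norm: "is_median M f 0 \<or> (integrable M f \<and> (LINT x|M. f x) = 0)"
  shows "(\<integral>\<^sup>+x. ennreal \<bar>f x\<bar> \<partial>M) \<le>
    2 * weight_constant M w * ennreal r * (\<integral>\<^sup>+x. grad_modulus f x \<partial>M)
      + 2 * ennreal (r powr (- \<alpha>)) * (\<integral>\<^sup>+x. ennreal \<bar>w x powr \<alpha> * f x\<bar> \<partial>M)"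
proof -
  obtain L where lip: "L-lipschitz_on UNIV f" using f by (auto simp: Lip_def)
  note [measurable] = w borel_measurable_lipschitz[OF lip]
  define P N where "P x = max (f x) 0" and "N x = max (- f x) 0" for x
  have [measurable]: "P \<in> borel_measurable M" "N \<in> borel_measurable M"
    unfolding P_def N_def by measurable
  define T where "T g = weight_constant M w * ennreal r * (\<integral>\<^sup>+x. grad_modulus f x \<partial>M)
      + ennreal (r powr (- \<alpha>)) * (\<integral>\<^sup>+x. ennreal (w x powr \<alpha> * g x) \<partial>M)" for g
  have PN_nonneg: "0 \<le> P x" "0 \<le> N x" for x by (auto simp: P_def N_def)
  have pos_set: "{x. 0 < P x} = {x \<in> space M. 0 < f x}" "{x. 0 < N x} = {x \<in> space M. f x < 0}"
    by (auto simp: P_def N_def space_eq)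
  have fin': "emeasure M (enlargement S 1) < \<infinity>" for S
    using emeasure_space[of M] fin by (rule le_less_trans)
  have P: "(\<integral>\<^sup>+x. ennreal (P x) \<partial>M) \<le> T P"
    if "emeasure M {x \<in> space M. 0 < f x} \<le> emeasure M (space M) / 2"
    unfolding T_def using that fin'
    by (intro weighted_inequality_contraction[OF w r \<alpha> lip, where h = 1]) (auto simp: P_def pos_set(1)[unfolded P_def])
  have N: "(\<integral>\<^sup>+x. ennreal (N x) \<partial>M) \<le> T N"
    if "emeasure M {x \<in> space M. f x < 0} \<le> emeasure M (space M) / 2"
    unfolding T_def using that fin'
    by (intro weighted_inequality_contraction[OF w r \<alpha> lip, where h = 1]) (auto simp: N_def pos_set(2)[unfolded N_def])
  have sum_weighted: "(\<integral>\<^sup>+x. ennreal (w x powr \<alpha> * P x) \<partial>M) + (\<integral>\<^sup>+x. ennreal (w x powr \<alpha> * N x) \<partial>M)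
      = (\<integral>\<^sup>+x. ennreal \<bar>w x powr \<alpha> * f x\<bar> \<partial>M)"
    by (subst nn_integral_add[symmetric])
       (auto intro!: nn_integral_cong simp: P_def N_def max_def abs_mult)
  have sum: "(\<integral>\<^sup>+x. ennreal \<bar>f x\<bar> \<partial>M) = (\<integral>\<^sup>+x. ennreal (P x) \<partial>M) + (\<integral>\<^sup>+x. ennreal (N x) \<partial>M)"
    by (subst nn_integral_add[symmetric]) (auto intro!: nn_integral_cong simp: P_def N_def max_def)
  define R where "R = 2 * weight_constant M w * ennreal r * (\<integral>\<^sup>+x. grad_modulus f x \<partial>M)
      + 2 * ennreal (r powr (- \<alpha>)) * (\<integral>\<^sup>+x. ennreal \<bar>w x powr \<alpha> * f x\<bar> \<partial>M)"
  have 2: "2 * T g = 2 * weight_constant M w * ennreal r * (\<integral>\<^sup>+x. grad_modulus f x \<partial>M)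
      + 2 * ennreal (r powr (- \<alpha>)) * (\<integral>\<^sup>+x. ennreal (w x powr \<alpha> * g x) \<partial>M)" for g
    by (simp add: T_def distrib_left mult.assoc)
  have T2: "2 * T P \<le> R" "2 * T N \<le> R"
    unfolding 2 R_def sum_weighted[symmetric] by (auto intro!: add_left_mono mult_left_mono)
  \<comment> \<open>Only the gradient term doubles here; the weighted terms of the two parts add up
    to that of \<open>f\<close>, and their factor 2 is slack.\<close>
  have TPN: "T P + T N \<le> R"
  proof -
    let ?c = "weight_constant M w * ennreal r * (\<integral>\<^sup>+x. grad_modulus f x \<partial>M)"
    let ?p = "ennreal (r powr (- \<alpha>)) * (\<integral>\<^sup>+x. ennreal (w x powr \<alpha> * P x) \<partial>M)"
    let ?n = "ennreal (r powr (- \<alpha>)) * (\<integral>\<^sup>+x. ennreal (w x powr \<alpha> * N x) \<partial>M)"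
    have "T P + T N = 2 * ?c + (?p + ?n)" unfolding T_def mult_2 by (simp only: ac_simps)
    also have "\<dots> \<le> 2 * ?c + 2 * (?p + ?n)"
      unfolding mult_2[of "?p + ?n"] by (intro add_left_mono add_increasing) auto
    also have "\<dots> = R"
      unfolding R_def sum_weighted[symmetric] by (simp only: distrib_left mult.assoc)
    finally show ?thesis .
  qed
  let ?m = "emeasure M (space M)"
  \<comment> \<open>If one of two disjoint sets has at least half of the mass, the other has at most
    half; finiteness allows cancelling \<open>?m / 2\<close>.\<close>
  have half: "X \<le> ?m / 2" if "X + Y \<le> ?m" "?m / 2 \<le> Y" for X Y
  proof -
    obtain m where m: "?m = ennreal m" "0 \<le> m" using fin by (cases ?m) auto
    then have hm: "?m / 2 = ennreal (m / 2)" by (simp add: ennreal_divide_numeral)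
    have "?m / 2 + X \<le> Y + X" using that(2) by (rule add_right_mono)
    also have "\<dots> \<le> ?m" using that(1) by (simp add: add.commute)
    also have "?m = ?m / 2 + ?m / 2" unfolding hm using m by (simp flip: ennreal_plus)
    finally show ?thesis unfolding ennreal_add_left_cancel_le by (simp add: hm)
  qed
  from norm show ?thesis
    unfolding R_def[symmetric]
  proof
    assume "is_median M f 0"
    then have med: "?m / 2 \<le> emeasure M {x \<in> space M. f x \<ge> 0}" "?m / 2 \<le> emeasure M {x \<in> space M. f x \<le> 0}"
      by (auto simp: is_median_def)
    have "emeasure M {x \<in> space M. 0 < f x} + emeasure M {x \<in> space M. f x \<le> 0} \<le> ?m"
      by (subst plus_emeasure) (auto intro!: emeasure_mono)
    moreover have "emeasure M {x \<in> space M. f x < 0} + emeasure M {x \<in> space M. f x \<ge> 0} \<le> ?m"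
      by (subst plus_emeasure) (auto intro!: emeasure_mono)
    ultimately show "(\<integral>\<^sup>+x. ennreal \<bar>f x\<bar> \<partial>M) \<le> R"
      unfolding sum using P N half med by (intro order_trans[OF add_mono TPN]) blast+
  next
    assume f0: "integrable M f \<and> (LINT x|M. f x) = 0"
    have iP: "integrable M P" "integrable M N" using f0 by (auto simp: P_def[abs_def] N_def[abs_def])
    have "(LINT x|M. f x) = (LINT x|M. P x - N x)"
      by (intro Bochner_Integration.integral_cong) (auto simp: P_def N_def max_def)
    then have "(LINT x|M. P x) = (LINT x|M. N x)" using f0 iP by simp
    then have eq: "(\<integral>\<^sup>+x. ennreal (P x) \<partial>M) = (\<integral>\<^sup>+x. ennreal (N x) \<partial>M)"
      using nn_integral_eq_integral[OF iP(1)] nn_integral_eq_integral[OF iP(2)] PN_nonneg by simp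
    have tot: "emeasure M {x \<in> space M. 0 < f x} + emeasure M {x \<in> space M. f x < 0} \<le> ?m"
      by (subst plus_emeasure) (auto intro!: emeasure_mono)
    show "(\<integral>\<^sup>+x. ennreal \<bar>f x\<bar> \<partial>M) \<le> R"
    \<comment> \<open>Either \<open>{f < 0}\<close> carries at least half of the mass and
      \<open>P\<close> qualifies, or \<open>N\<close> itself does. By \<open>eq\<close>, twice
      either integral is the norm of \<open>f\<close>.\<close>
    proof (cases "?m / 2 \<le> emeasure M {x \<in> space M. f x < 0}")
      case True
      then have "2 * (\<integral>\<^sup>+x. ennreal (P x) \<partial>M) \<le> 2 * T P"
        by (intro mult_left_mono P half[OF tot]) auto
      then show ?thesis unfolding sum eq[symmetric] using T2 by (simp add: mult_2)
    next
      case False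
      then have "2 * (\<integral>\<^sup>+x. ennreal (N x) \<partial>M) \<le> 2 * T N"
        by (intro mult_left_mono N) auto
      then show ?thesis unfolding sum eq using T2 by (simp add: mult_2)
    qed
  qed
qed

text \<open>A neighbourhood of the compact support may have infinite measure, so the inequality is
  applied to \<open>(\<bar>f\<bar> - \<epsilon>)\<^sup>+\<close>, whose support has a neighbourhood inside that of \<open>f\<close>.\<close>

lemma weighted_inequality_infinite:
  assumes w: "w \<in> borel_measurable M" and r: "0 < r" and \<alpha>: "0 < \<alpha>"
    and inf: "emeasure M (space M) = \<infinity>" and f: "f \<in> Lip0"
  shows "(\<integral>\<^sup>+x. ennreal \<bar>f x\<bar> \<partial>M) \<le>
    weight_constant M w * ennreal r * (\<integral>\<^sup>+x. grad_modulus f x \<partial>M)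
      + ennreal (r powr (- \<alpha>)) * (\<integral>\<^sup>+x. ennreal \<bar>w x powr \<alpha> * f x\<bar> \<partial>M)" (is "_ \<le> ?R")
proof -
  obtain L where lip: "L-lipschitz_on UNIV f" and K: "compact (closure {x. f x \<noteq> 0})"
    using f by (auto simp: Lip0_def Lip_def)
  note [measurable] = w borel_measurable_lipschitz[OF lip]
  have L0: "0 \<le> L" using lip by (rule lipschitz_on_nonneg)
  define \<epsilon> where "\<epsilon> n = inverse (real (Suc n))" for n
  define g where "g n x = max (\<bar>f x\<bar> - \<epsilon> n) 0" for n x
  have \<epsilon>: "0 < \<epsilon> n" for n by (simp add: \<epsilon>_def)
  have bound: "(\<integral>\<^sup>+x. ennreal (g n x) \<partial>M) \<le> ?R" for n
  proof -
    \<comment> \<open>Over a distance \<open>h\<close> the function \<open>f\<close> changes by at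
      most \<open>\<epsilon> n\<close>, so it cannot vanish near a point with
      \<open>\<bar>f y\<bar> > \<epsilon> n\<close>. The added 1 keeps the divisor positive when
      \<open>L = 0\<close>.\<close>
    define h where "h = \<epsilon> n / (L + 1)"
    have h: "0 < h" using \<epsilon> L0 by (simp add: h_def)
    have "x \<in> closure {x. f x \<noteq> 0}" if x: "x \<in> enlargement {x. 0 < g n x} h" for x
    proof -
      obtain y where y: "\<epsilon> n < \<bar>f y\<bar>" "dist x y < h"
        using x by (auto simp: enlargement_eq g_def max_def split: if_splits)
      have "\<bar>f x - f y\<bar> \<le> L * dist x y"
        using lipschitz_onD[OF lip, of x y] by (simp add: dist_real_def)
      also have "\<dots> \<le> L * h" using y L0 by (intro mult_left_mono) auto
      also have "\<dots> \<le> \<epsilon> n" using L0 \<epsilon>[of n] by (simp add: h_def divide_le_eq algebra_simps)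
      finally have "f x \<noteq> 0" using y by auto
      then show ?thesis using closure_subset[of "{x. f x \<noteq> 0}"] by auto
    qed
    then have "emeasure M (enlargement {x. 0 < g n x} h) \<le> emeasure M (closure {x. f x \<noteq> 0})"
      by (intro emeasure_mono) (auto simp: sets_eq_borel)
    then have fin: "emeasure M (enlargement {x. 0 < g n x} h) < \<infinity>"
      using compact_finite[OF K] by order
    have "(\<integral>\<^sup>+x. ennreal (g n x) \<partial>M) \<le>
        weight_constant M w * ennreal r * (\<integral>\<^sup>+x. grad_modulus f x \<partial>M)
          + ennreal (r powr (- \<alpha>)) * (\<integral>\<^sup>+x. ennreal (w x powr \<alpha> * g n x) \<partial>M)"
      using \<epsilon>[of n]
      by (intro weighted_inequality_contraction[OF w r \<alpha> lip _ _ h fin])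
         (auto simp: g_def inf ennreal_top_divide)
    also have "\<dots> \<le> ?R"
      using \<epsilon>[of n]
      by (intro add_left_mono mult_left_mono nn_integral_mono ennreal_leI)
         (auto simp: g_def abs_mult intro!: mult_left_mono)
    finally show ?thesis .
  qed
  have lim: "(\<lambda>n. ennreal (g n x)) \<longlonglongrightarrow> ennreal \<bar>f x\<bar>" for x
  proof -
    have "(\<lambda>n. max (\<bar>f x\<bar> - \<epsilon> n) 0) \<longlonglongrightarrow> max (\<bar>f x\<bar> - 0) 0"
      unfolding \<epsilon>_def by (intro tendsto_intros LIMSEQ_inverse_real_of_nat)
    then show ?thesis unfolding g_def by (intro tendsto_ennrealI) simp
  qed
  \<comment> \<open>The bound is uniform in \<open>n\<close>, so Fatou carries it to the pointwise
    limit \<open>\<bar>f\<bar>\<close> of the truncations.\<close>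
  have "(\<integral>\<^sup>+x. ennreal \<bar>f x\<bar> \<partial>M) = (\<integral>\<^sup>+x. liminf (\<lambda>n. ennreal (g n x)) \<partial>M)"
    by (intro nn_integral_cong lim_imp_Liminf[symmetric] lim) auto
  also have "\<dots> \<le> liminf (\<lambda>n. \<integral>\<^sup>+x. ennreal (g n x) \<partial>M)"
    unfolding g_def by (intro nn_integral_liminf) measurable
  also have "\<dots> \<le> ?R"
    using bound by (intro Liminf_le) auto
  finally show ?thesis .
qed

end

theorem theorem3:
  fixes M :: "'a::metric_space measure" and w :: "'a \<Rightarrow> real" and \<alpha> :: real
  assumes "isoperimetric_space M"
    and "isoperimetric_weight M w"
    and "\<alpha> > 0"
  shows "(emeasure M (space M) < \<infinity> \<longrightarrow>
      (\<forall>f\<in>Lip. is_median M f 0 \<or> (integrable M f \<and> (LINT x|M. f x) = 0) \<longrightarrow>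
        (\<forall>r>0. (\<integral>\<^sup>+x. ennreal \<bar>f x\<bar> \<partial>M)
          \<le> 2 * weight_constant M w * ennreal r * (\<integral>\<^sup>+x. grad_modulus f x \<partial>M)
            + 2 * ennreal (r powr (- \<alpha>)) * (\<integral>\<^sup>+x. ennreal \<bar>w x powr \<alpha> * f x\<bar> \<partial>M)))) \<and>
    (emeasure M (space M) = \<infinity> \<longrightarrow>
      (\<forall>f\<in>Lip0.
        (\<forall>r>0. (\<integral>\<^sup>+x. ennreal \<bar>f x\<bar> \<partial>M)
          \<le> 2 * weight_constant M w * ennreal r * (\<integral>\<^sup>+x. grad_modulus f x \<partial>M)
            + 2 * ennreal (r powr (- \<alpha>)) * (\<integral>\<^sup>+x. ennreal \<bar>w x powr \<alpha> * f x\<bar> \<partial>M))))"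
proof -
  interpret isoperimetric_space M by fact
  have w: "w \<in> borel_measurable M" using assms(2) by (simp add: isoperimetric_weight_def)
  \<comment> \<open>For infinite measure the inequality was obtained with constant 1 in both terms;
    doubling the right side gives the common form.\<close>
  have double: "X \<le> 2 * a * b * c + 2 * d * e" if "X \<le> a * b * c + d * e" for X a b c d e :: ennreal
  proof -
    have "a * b * c + d * e \<le> 2 * (a * b * c + d * e)"
      unfolding mult_2 by (rule add_increasing) auto
    with that have "X \<le> 2 * (a * b * c + d * e)" by (rule order_trans)
    then show ?thesis by (simp add: distrib_left mult.assoc)
  qed
  show ?thesis
    using weighted_inequality_finite[OF w _ assms(3)]
      double[OF weighted_inequality_infinite[OF w _ assms(3)]]
    by blast
qed

end
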